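(* Let $n$ be an even nonnegative integer and let $z_n=\mathbb{E}((\det X)^2)$, where $X$ is chosen uniformly at random among the Seidel matrices of tournaments of order $n$. Then $z_n=y_n\cdot(n-1)!!$, where $y_n$ is given by the recurrence $y_0=1$, $y_2=1$, and $y_n=(n-1)y_{n-2}+(2n-4)y_{n-4}$ for even $n\ge 4$.
   Context: A tournament of order $n$ is a digraph on $\{1,\dots,n\}$ with exactly one of the arcs $ij$, $ji$ for each pair $i\ne j$. Its Seidel matrix $S=[s_{ij}]$ is the $n\times n$ skew-symmetric matrix with zero diagonal, $s_{ij}=1$ if $ij$ is an arc and $s_{ij}=-1$ otherwise; all $2^{\binom n2}$ of them are equally likely. The double factorial is defined by $0!!=1!!=1$ (and $(-1)!!=1$) and $n!!=n\cdot(n-2)!!$ for $n\ge 2$. *)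

theory Defs
  imports
    "Jordan_Normal_Form.Determinant"
    "Graph_Theory.Pair_Digraph"
    "HOL-Probability.Probability_Mass_Function"
begin

definition tournament :: "nat \<Rightarrow> nat pair_pre_digraph \<Rightarrow> bool" where
  "tournament n G \<longleftrightarrow> pair_digraph G \<and> pverts G = {1..n} \<and>
     (\<forall>i\<in>{1..n}. \<forall>j\<in>{1..n}. i \<noteq> j \<longrightarrow> ((i, j) \<in> parcs G \<longleftrightarrow> (j, i) \<notin> parcs G))"

text \<open>Vertices are numbered from 1, matrix indices from 0, hence the shift.\<close>

definition seidel_matrix :: "nat \<Rightarrow> nat pair_pre_digraph \<Rightarrow> real mat" where
  "seidel_matrix n G = Matrix.mat n n
     (\<lambda>(i, j). if i = j then 0 else if (i + 1, j + 1) \<in> parcs G then 1 else - 1)"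

definition seidel_matrices :: "nat \<Rightarrow> real mat set" where
  "seidel_matrices n = seidel_matrix n ` {G. tournament n G}"

text \<open>On its intended domain, the integers from -1 upwards, this is the usual double
  factorial; below that its value 1 has no significance.\<close>

function dfact :: "int \<Rightarrow> int" where
  "dfact k = (if k \<le> 1 then 1 else k * dfact (k - 2))"
  by auto
termination by (relation "Wellfounded.measure nat") auto

declare dfact.simps [simp del]

lemma finite_tournaments: "finite {G. tournament n G}"
proof (rule finite_subset)
  show "{G. tournament n G} \<subseteq>
      (\<lambda>A. \<lparr>pverts = {1..n}, parcs = A\<rparr>) ` Pow ({1..n} \<times> {1..n})"
  proof
    fix G assume "G \<in> {G. tournament n G}"
    then have "pair_digraph G" and V: "pverts G = {1..n}"
      unfolding tournament_def by blast+
    then have wf: "pair_wf_digraph G"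
      by (simp add: pair_digraph_def pair_fin_digraph_def)
    have "parcs G \<subseteq> {1..n} \<times> {1..n}"
      using pair_wf_digraph.in_arcsD1[OF wf] pair_wf_digraph.in_arcsD2[OF wf] V
      by (intro subrelI) blast
    moreover have "G = \<lparr>pverts = {1..n}, parcs = parcs G\<rparr>"
      using V by simp
    ultimately show "G \<in> (\<lambda>A. \<lparr>pverts = {1..n}, parcs = A\<rparr>) ` Pow ({1..n} \<times> {1..n})"
      by blast
  qed
qed simp

text \<open>The next two facts are what makes \<^term>\<open>pmf_of_set (seidel_matrices n)\<close> the uniform
  distribution; it is unspecified for infinite or empty sets.  By injectivity of
  \<^const>\<open>seidel_matrix\<close>, choosing a matrix uniformly is the same as choosing
  a tournament uniformly.\<close>

lemma finite_seidel_matrices: "finite (seidel_matrices n)"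
  unfolding seidel_matrices_def by (rule finite_imageI[OF finite_tournaments])

lemma seidel_matrices_nonempty: "seidel_matrices n \<noteq> {}"
proof -
  let ?A = "{(i, j). i \<in> {1..n} \<and> j \<in> {1..n} \<and> i < j}"
  have "finite ?A" by (rule finite_subset[of _ "{1..n} \<times> {1..n}"]) auto
  then have "tournament n \<lparr>pverts = {1..n}, parcs = ?A\<rparr>"
    unfolding tournament_def pair_digraph_def pair_fin_digraph_def pair_loopfree_digraph_def
      pair_wf_digraph_def pair_fin_digraph_axioms_def pair_loopfree_digraph_axioms_def
    by auto
  then show ?thesis unfolding seidel_matrices_def by blast
qed

lemma inj_on_seidel_matrix: "inj_on (seidel_matrix n) {G. tournament n G}"
proof (rule inj_onI)
  fix G H assume GH: "G \<in> {G. tournament n G}" "H \<in> {G. tournament n G}"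
    and eq: "seidel_matrix n G = seidel_matrix n H"
  have sub: "parcs G' \<subseteq> parcs H'"
    if G': "tournament n G'" and eq': "seidel_matrix n G' = seidel_matrix n H'" for G' H'
  proof safe
    fix i j assume e: "(i, j) \<in> parcs G'"
    have d: "pair_digraph G'" and V: "pverts G' = {1..n}"
      using G' unfolding tournament_def by blast+
    have wf: "pair_wf_digraph G'" and lf: "pair_loopfree_digraph G'"
      using d by (simp_all add: pair_digraph_def pair_fin_digraph_def)
    have ij: "i \<in> {1..n}" "j \<in> {1..n}" "i \<noteq> j"
      using pair_wf_digraph.in_arcsD1[OF wf e] pair_wf_digraph.in_arcsD2[OF wf e]
        pair_loopfree_digraph.pair_no_loops[OF lf e] V by auto
    have "seidel_matrix n G' $$ (i - 1, j - 1) = 1"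
      using ij e by (auto simp: seidel_matrix_def)
    then have "seidel_matrix n H' $$ (i - 1, j - 1) = 1" using eq' by simp
    then show "(i, j) \<in> parcs H'"
      using ij by (auto simp: seidel_matrix_def split: if_splits)
  qed
  show "G = H"
  proof (rule pair_pre_digraph.equality)
    show "pverts G = pverts H" using GH by (simp add: tournament_def)
    show "parcs G = parcs H" using sub[of G H] sub[of H G] GH eq by (simp add: subset_antisym)
  qed simp
qed

end

theory Submission
  imports Defs
begin

text \<open>Write the Seidel matrix of order \<open>k + 1\<close> as the skew border of a Seidel matrix \<open>B\<close> of odd
  order \<open>k\<close> by a random sign vector \<open>x\<close>.  Then \<open>det X = x\<^sup>T C x\<close> with \<open>C = adj B\<close>, which is symmetric
  of rank at most one because \<open>det B = 0\<close>.  Averaging the square over the independent signs in \<open>x\<close>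
  leaves \<open>3 (tr C)\<^sup>2 - 2 \<Sum> C\<^sub>i\<^sub>i\<^sup>2\<close>, and the \<open>C\<^sub>i\<^sub>i\<close> are the principal minors of order \<open>k - 1\<close>.  With
  \<open>w\<^sub>k = E((tr adj B)\<^sup>2)\<close> this reads \<open>z\<^sub>k\<^sub>+\<^sub>1 = 3 w\<^sub>k - 2 k z\<^sub>k\<^sub>-\<^sub>1\<close>.  Two distinct principal minors of
  order \<open>k - 1\<close> border the same matrix of order \<open>k - 2\<close> by independent sign vectors, whence
  \<open>w\<^sub>k = k z\<^sub>k\<^sub>-\<^sub>1 + k (k - 1) w\<^sub>k\<^sub>-\<^sub>2\<close>.  Eliminating \<open>w\<close> gives the recurrence
  \<open>z\<^sub>n = (n - 1)\<^sup>2 z\<^sub>n\<^sub>-\<^sub>2 + 2 (n - 1)(n - 2)(n - 3) z\<^sub>n\<^sub>-\<^sub>4\<close>, which \<open>y\<^sub>n (n - 1)!!\<close> satisfies too.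
  Independence enters only through the involution that reverses a single arc.\<close>

section \<open>Adjugates of singular and of skew-symmetric matrices\<close>

text \<open>A nonzero cofactor leaves a kernel of dimension at most one; the form used below is that
  a kernel vector is determined by its entry at \<open>j\<close>.\<close>

lemma kernel_vec_zero_if_cofactor_nonzero:
  fixes B :: "'a :: field mat"
  assumes B: "B \<in> carrier_mat k k" and ij: "i < k" "j < k"
    and cof: "cofactor B i j \<noteq> 0"
    and v: "v \<in> carrier_vec k" "B *\<^sub>v v = 0\<^sub>v k" "vec_index v j = 0"
  shows "v = 0\<^sub>v k"
proof -
  \<comment> \<open>Replacing row \<open>i\<close> by a unit vector turns the cofactor into a determinant.\<close>
  define Y where "Y = Matrix.mat k k (\<lambda>(a, b). if a = i then (if b = j then 1 else 0) else B $$ (a, b))"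
  have Y: "Y \<in> carrier_mat k k" by (simp add: Y_def)
  have del: "mat_delete Y i b = mat_delete B i b" for b
    using B ij by (intro eq_matI) (auto simp: mat_delete_def Y_def)
  have "Determinant.det Y = (\<Sum>b<k. Y $$ (i, b) * cofactor Y i b)"
    by (rule laplace_expansion_row[OF Y ij(1)])
  also have "\<dots> = (\<Sum>b<k. if b = j then cofactor B i j else 0)"
    using ij by (intro sum.cong) (auto simp: cofactor_def del, simp_all add: Y_def)
  also have "\<dots> = cofactor B i j" using ij by simp
  finally have "Determinant.det Y \<noteq> 0" using cof by simp
  moreover have "Y *\<^sub>v v = 0\<^sub>v k"
  proof (rule eq_vecI)
    fix a assume "a < dim_vec (0\<^sub>v k :: 'a Matrix.vec)"
    then have a: "a < k" by simp
    show "vec_index (Y *\<^sub>v v) a = vec_index (0\<^sub>v k) a"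
    proof (cases "a = i")
      case True
      have "vec_index (Y *\<^sub>v v) a = (\<Sum>b = 0..<k. (if b = j then 1 else 0) * vec_index v b)"
        using a v(1) True by (simp add: Y_def scalar_prod_def)
      also have "\<dots> = 0" using v(3) by (intro sum.neutral) auto
      finally show ?thesis using a by simp
    next
      case False
      have "vec_index (Y *\<^sub>v v) a = vec_index (B *\<^sub>v v) a"
        using a v(1) B False by (simp add: Y_def scalar_prod_def)
      then show ?thesis using v(2) by simp
    qed
  qed (simp add: Y_def)
  ultimately show ?thesis using det_0_iff_vec_prod_zero_field[OF Y] v(1) by blast
qed

text \<open>The columns of the adjugate of a singular matrix lie in its kernel, which is at most a
  line once some cofactor is nonzero. Hence all two by two minors of the adjugate vanish.\<close>

lemma adj_mat_rank_one:
  fixes B :: "'a :: field mat"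
  assumes B: "B \<in> carrier_mat k k" and sing: "Determinant.det B = 0"
    and "p < k" "q < k" "r < k" "s < k"
  shows "adj_mat B $$ (p, q) * adj_mat B $$ (s, r) = adj_mat B $$ (p, r) * adj_mat B $$ (s, q)"
proof -
  let ?C = "adj_mat B"
  have C: "?C \<in> carrier_mat k k" and BC: "B * ?C = 0\<^sub>m k k"
    using adj_mat[OF B] sing by auto
  have ker: "(\<Sum>b = 0..<k. B $$ (a, b) * ?C $$ (b, c)) = 0" if "a < k" "c < k" for a c
  proof -
    have "(B * ?C) $$ (a, c) = 0" using BC that by simp
    then show ?thesis using that B C by (simp add: scalar_prod_def)
  qed
  have key: "?C $$ (p, q) * ?C $$ (s, r) = ?C $$ (p, r) * ?C $$ (s, q)"
    if q: "q < k" and r: "r < k" and nz: "?C $$ (p, q) \<noteq> 0" for q r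
  proof -
    \<comment> \<open>The columns of the adjugate lie in the kernel; this combination of two of them also vanishes
      at \<open>p\<close>.\<close>
    define v where "v = Matrix.vec k (\<lambda>b. ?C $$ (p, q) * ?C $$ (b, r) - ?C $$ (p, r) * ?C $$ (b, q))"
    \<comment> \<open>The adjugate transposes the indices: its entry at \<open>(p, q)\<close> is the
      cofactor at \<open>(q, p)\<close>.\<close>
    have "cofactor B q p \<noteq> 0" using nz B q assms(3) by (simp add: adj_mat_def)
    moreover have "B *\<^sub>v v = 0\<^sub>v k"
    proof (rule eq_vecI)
      fix a assume "a < dim_vec (0\<^sub>v k :: 'a Matrix.vec)"
      then have a: "a < k" by simp
      have "vec_index (B *\<^sub>v v) a = (\<Sum>b = 0..<k. B $$ (a, b) * (?C $$ (p, q) * ?C $$ (b, r) - ?C $$ (p, r) * ?C $$ (b, q)))"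
        using a B by (simp add: v_def scalar_prod_def)
      also have "\<dots> = ?C $$ (p, q) * (\<Sum>b = 0..<k. B $$ (a, b) * ?C $$ (b, r))
          - ?C $$ (p, r) * (\<Sum>b = 0..<k. B $$ (a, b) * ?C $$ (b, q))"
        by (simp add: algebra_simps sum_subtractf sum_distrib_left)
      also have "\<dots> = 0" using ker a q r by simp
      finally show "vec_index (B *\<^sub>v v) a = vec_index (0\<^sub>v k) a" using a by simp
    qed (use B in \<open>simp add: v_def\<close>)
    moreover have "v \<in> carrier_vec k" by (simp add: v_def)
    moreover have "vec_index v p = 0" using assms(3) by (simp add: v_def)
    ultimately have "v = 0\<^sub>v k"
      using kernel_vec_zero_if_cofactor_nonzero[OF B q assms(3)] by blast
    then have "vec_index v s = 0" using assms(6) by simp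
    then show ?thesis using assms(6) by (simp add: v_def)
  qed
  \<comment> \<open>The identity is symmetric in \<open>q\<close> and \<open>r\<close>, so one
    nonzero entry of row \<open>p\<close> suffices; if both entries are zero, both sides
    vanish.\<close>
  consider "?C $$ (p, q) \<noteq> 0" | "?C $$ (p, r) \<noteq> 0" | "?C $$ (p, q) = 0" "?C $$ (p, r) = 0"
    by blast
  then show ?thesis
  proof cases
    case 1 then show ?thesis using key assms by blast
  next
    case 2 then show ?thesis using key[of r q] assms by simp
  next
    case 3 then show ?thesis by simp
  qed
qed

lemma transpose_mat_delete:
  assumes "i < dim_row A" "j < dim_col A"
  shows "transpose_mat (mat_delete A i j) = mat_delete (transpose_mat A) j i"
  using assms by (intro eq_matI) (auto simp: mat_delete_def)

text \<open>Negation multiplies the determinant by \<open>(-1) ^ k = -1\<close>, while transposition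
  preserves it; characteristic zero does the rest.\<close>

lemma det_skew_odd:
  fixes B :: "'a :: field_char_0 mat"
  assumes B: "B \<in> carrier_mat k k" and skew: "transpose_mat B = - B" and "odd k"
  shows "Determinant.det B = 0"
proof -
  have "- B = (-1) \<cdot>\<^sub>m B" by (intro eq_matI) auto
  with skew have "transpose_mat B = (-1) \<cdot>\<^sub>m B" by simp
  then have "Determinant.det B = (-1) ^ k * Determinant.det B"
    using Determinant.det_transpose[OF B] B by simp
  then show ?thesis using \<open>odd k\<close> by simp
qed

text \<open>Transposing a submatrix of order \<open>k - 1\<close> exchanges the deleted row and
  column and negates the entries; \<open>(-1) ^ (k - 1) = 1\<close> for odd
  \<open>k\<close>.\<close>

lemma adj_mat_skew_odd_symmetric:
  fixes B :: "'a :: field mat"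
  assumes B: "B \<in> carrier_mat k k" and skew: "transpose_mat B = - B" and "odd k"
    and i: "i < k" and j: "j < k"
  shows "adj_mat B $$ (i, j) = adj_mat B $$ (j, i)"
proof -
  have D: "mat_delete B j i \<in> carrier_mat (k - 1) (k - 1)"
    using B by (rule mat_delete_carrier)
  have "transpose_mat (mat_delete B j i) = (-1) \<cdot>\<^sub>m mat_delete B i j"
    using B i j
    by (subst transpose_mat_delete) (auto simp: skew mat_delete_def intro!: eq_matI)
  then have "Determinant.det (mat_delete B j i) = (-1) ^ (k - 1) * Determinant.det (mat_delete B i j)"
    using Determinant.det_transpose[OF D] B by simp
  then have "Determinant.det (mat_delete B j i) = Determinant.det (mat_delete B i j)"
    using \<open>odd k\<close> by simp
  then show ?thesis using B i j by (simp add: adj_mat_def cofactor_def add.commute)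
qed

text \<open>Expand along row 0, then each minor along column 0. The minus sign from skew-symmetry
  cancels the one by which the row expansion is shifted against the cofactor signs of
  \<open>B\<close>.\<close>

lemma det_skew_border:
  fixes A :: "'a :: comm_ring_1 mat"
  assumes A: "A \<in> carrier_mat (Suc k) (Suc k)" and skew: "transpose_mat A = - A"
    and A00: "A $$ (0, 0) = 0"
  defines "B \<equiv> mat_delete A 0 0"
  shows "Determinant.det A = (\<Sum>i<k. \<Sum>j<k. A $$ (0, Suc i) * A $$ (0, Suc j) * adj_mat B $$ (i, j))"
proof -
  have B: "B \<in> carrier_mat k k" using mat_delete_carrier[OF A] by (simp add: B_def)
  have sk: "A $$ (Suc i, 0) = - A $$ (0, Suc i)" if "i < k" for i
  proof -
    have "transpose_mat A $$ (0, Suc i) = (- A) $$ (0, Suc i)" by (simp add: skew)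
    then show ?thesis using A that by simp
  qed
  have minor: "cofactor A 0 (Suc i) = (\<Sum>j<k. A $$ (0, Suc j) * adj_mat B $$ (i, j))" if i: "i < k" for i
  proof -
    let ?M = "mat_delete A 0 (Suc i)"
    have M: "?M \<in> carrier_mat k k" using mat_delete_carrier[OF A] by simp
    have k: "0 < k" using i by simp
    \<comment> \<open>Altogether rows \<open>0\<close>, \<open>Suc j\<close> and columns
      \<open>0\<close>, \<open>Suc i\<close> of \<open>A\<close> are deleted. What is left gives the
      cofactor of \<open>B\<close> at \<open>(j, i)\<close>, which is the adjugate at
      \<open>(i, j)\<close>.\<close>
    have del: "mat_delete ?M j 0 = mat_delete B j i" if "j < k" for j
      using A that i unfolding B_def by (intro eq_matI) (auto simp: mat_delete_def)
    have "Determinant.det ?M = (\<Sum>j<k. ?M $$ (j, 0) * cofactor ?M j 0)"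
      by (rule laplace_expansion_column[OF M k])
    also have "\<dots> = (\<Sum>j<k. - A $$ (0, Suc j) * ((-1) ^ j * Determinant.det (mat_delete B j i)))"
      using A sk k by (intro sum.cong refl) (simp add: cofactor_def del, simp add: mat_delete_def)
    finally have "cofactor A 0 (Suc i)
        = (-1) ^ Suc i * (\<Sum>j<k. - A $$ (0, Suc j) * ((-1) ^ j * Determinant.det (mat_delete B j i)))"
      by (simp add: cofactor_def)
    also have "\<dots> = (\<Sum>j<k. A $$ (0, Suc j) * adj_mat B $$ (i, j))"
      unfolding sum_distrib_left
      using B i by (intro sum.cong refl) (simp add: adj_mat_def cofactor_def power_add)
    finally show ?thesis .
  qed
  have "Determinant.det A = (\<Sum>i<Suc k. A $$ (0, i) * cofactor A 0 i)"
    by (rule laplace_expansion_row[OF A]) simp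
  also have "\<dots> = (\<Sum>i<k. A $$ (0, Suc i) * cofactor A 0 (Suc i))"
    by (subst sum.lessThan_Suc_shift) (simp add: A00)
  finally show ?thesis by (simp add: minor sum_distrib_left mult.assoc)
qed

section \<open>Seidel matrices described by their entries\<close>

text \<open>This removes digraphs from the argument. Conversely, the positions of the entries 1 are
  taken as arcs, and skew-symmetry selects exactly one of each opposite pair.\<close>

lemma seidel_matrices_eq:
  "seidel_matrices n = {X \<in> carrier_mat n n. (\<forall>i<n. X $$ (i, i) = 0) \<and>
     (\<forall>i<n. \<forall>j<n. i \<noteq> j \<longrightarrow> X $$ (i, j) \<in> {-1, 1} \<and> X $$ (j, i) = - X $$ (i, j))}"
  (is "_ = ?R")
proof (intro subset_antisym subsetI)
  fix X assume "X \<in> seidel_matrices n"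
  then obtain G where G: "tournament n G" and X: "X = seidel_matrix n G"
    by (auto simp: seidel_matrices_def)
  have "X $$ (i, j) \<in> {-1, 1} \<and> X $$ (j, i) = - X $$ (i, j)" if "i < n" "j < n" "i \<noteq> j" for i j
  proof -
    have "i + 1 \<in> {1..n}" "j + 1 \<in> {1..n}" "i + 1 \<noteq> j + 1" using that by auto
    then have "(i + 1, j + 1) \<in> parcs G \<longleftrightarrow> (j + 1, i + 1) \<notin> parcs G"
      using G unfolding tournament_def by blast
    then show ?thesis
      using that by (cases "(i + 1, j + 1) \<in> parcs G") (simp_all add: X seidel_matrix_def)
  qed
  moreover have "X \<in> carrier_mat n n" "\<forall>i<n. X $$ (i, i) = 0" by (simp_all add: X seidel_matrix_def)
  ultimately show "X \<in> ?R" by blast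
next
  fix X assume X: "X \<in> ?R"
  then have carrier: "X \<in> carrier_mat n n" by blast
  have diag: "X $$ (i, i) = 0" if "i < n" for i using X that by blast
  have offdiag: "X $$ (i, j) = 1 \<or> X $$ (i, j) = -1" if "i < n" "j < n" "i \<noteq> j" for i j
    using X that by blast
  define A where "A = {(i, j). i \<in> {1..n} \<and> j \<in> {1..n} \<and> X $$ (i - 1, j - 1) = 1}"
  have fin: "finite A" by (rule finite_subset[of _ "{1..n} \<times> {1..n}"]) (auto simp: A_def)
  have anti: "(i, j) \<in> A \<longleftrightarrow> (j, i) \<notin> A" if "i \<in> {1..n}" "j \<in> {1..n}" "i \<noteq> j" for i j
  proof -
    have "i - 1 < n" "j - 1 < n" "i - 1 \<noteq> j - 1" using that by auto
    then have "X $$ (i - 1, j - 1) \<in> {-1, 1}" "X $$ (j - 1, i - 1) = - X $$ (i - 1, j - 1)"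
      using X by blast+
    then show ?thesis using that by (auto simp: A_def)
  qed
  have "i \<noteq> j" if "(i, j) \<in> A" for i j
  proof
    assume "i = j"
    with that have "i - 1 < n" "X $$ (i - 1, i - 1) = 1" by (auto simp: A_def)
    then show False using diag by simp
  qed
  moreover have "i \<in> {1..n} \<and> j \<in> {1..n}" if "(i, j) \<in> A" for i j using that by (auto simp: A_def)
  ultimately have "pair_digraph \<lparr>pverts = {1..n}, parcs = A\<rparr>"
    using fin unfolding pair_digraph_def pair_fin_digraph_def pair_loopfree_digraph_def
      pair_wf_digraph_def pair_fin_digraph_axioms_def pair_loopfree_digraph_axioms_def
    by auto
  then have "tournament n \<lparr>pverts = {1..n}, parcs = A\<rparr>"
    unfolding tournament_def pair_pre_digraph.simps using anti by blast
  moreover have "X = seidel_matrix n \<lparr>pverts = {1..n}, parcs = A\<rparr>"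
    using carrier diag offdiag by (intro eq_matI) (auto simp: seidel_matrix_def A_def)
  ultimately show "X \<in> seidel_matrices n" by (auto simp: seidel_matrices_def)
qed

lemma seidel_matrix_carrier: "X \<in> seidel_matrices n \<Longrightarrow> X \<in> carrier_mat n n"
  unfolding seidel_matrices_eq by blast

lemma seidel_matrix_diag: "X \<in> seidel_matrices n \<Longrightarrow> i < n \<Longrightarrow> X $$ (i, i) = 0"
  unfolding seidel_matrices_eq by blast

lemma seidel_matrix_skew:
  assumes "X \<in> seidel_matrices n" "i < n" "j < n"
  shows "X $$ (j, i) = - X $$ (i, j)"
proof (cases "i = j")
  case True
  then show ?thesis using seidel_matrix_diag[OF assms(1,2)] by simp
next
  case False
  then show ?thesis using assms unfolding seidel_matrices_eq by blast
qed

lemma seidel_matrix_entry_sq: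
  assumes "X \<in> seidel_matrices n" "i < n" "j < n" "i \<noteq> j"
  shows "X $$ (i, j) * X $$ (i, j) = 1"
proof -
  have "X $$ (i, j) \<in> {-1, 1}" using assms unfolding seidel_matrices_eq by blast
  then show ?thesis by auto
qed

section \<open>Averages and the reversal of an arc\<close>

definition avg :: "nat \<Rightarrow> (real mat \<Rightarrow> real) \<Rightarrow> real" where
  "avg n F = (\<Sum>X\<in>seidel_matrices n. F X) / card (seidel_matrices n)"

lemma avg_cong: "(\<And>X. X \<in> seidel_matrices n \<Longrightarrow> F X = G X) \<Longrightarrow> avg n F = avg n G"
  unfolding avg_def by simp

lemma avg_const: "avg n (\<lambda>_. c) = c"
  using finite_seidel_matrices seidel_matrices_nonempty by (simp add: avg_def)

lemma avg_sum: "avg n (\<lambda>X. \<Sum>i\<in>I. F i X) = (\<Sum>i\<in>I. avg n (F i))"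
proof -
  have "(\<Sum>X\<in>seidel_matrices n. \<Sum>i\<in>I. F i X) = (\<Sum>i\<in>I. \<Sum>X\<in>seidel_matrices n. F i X)"
    by (rule sum.swap)
  then show ?thesis unfolding avg_def by (simp add: sum_divide_distrib)
qed

text \<open>Reversal of the arc between \<open>a\<close> and \<open>b\<close>. Comparing unordered
  pairs negates both mirror entries, which preserves skew-symmetry.\<close>

definition flip :: "nat \<Rightarrow> nat \<Rightarrow> real mat \<Rightarrow> real mat" where
  "flip a b X = Matrix.mat (dim_row X) (dim_col X)
     (\<lambda>(i, j). if {i, j} = {a, b} then - X $$ (i, j) else X $$ (i, j))"

lemma index_flip [simp]:
  "i < dim_row X \<Longrightarrow> j < dim_col X \<Longrightarrow>
    flip a b X $$ (i, j) = (if {i, j} = {a, b} then - X $$ (i, j) else X $$ (i, j))"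
  by (simp add: flip_def)

lemma flip_flip: "flip a b (flip a b X) = X"
  by (intro eq_matI) (auto simp: flip_def)

lemma flip_in_seidel_matrices:
  assumes "X \<in> seidel_matrices n"
  shows "flip a b X \<in> seidel_matrices n"
proof -
  have X: "X \<in> carrier_mat n n" using assms by (rule seidel_matrix_carrier)
  have "flip a b X $$ (i, j) \<in> {-1, 1} \<and> flip a b X $$ (j, i) = - flip a b X $$ (i, j)"
    if "i < n" "j < n" "i \<noteq> j" for i j
  proof -
    have "X $$ (i, j) \<in> {-1, 1}" "X $$ (j, i) = - X $$ (i, j)"
      using assms that unfolding seidel_matrices_eq by blast+
    then show ?thesis using that X by (simp add: insert_commute[of j i]) auto
  qed
  moreover have "flip a b X $$ (i, i) = 0" if "i < n" for i
    using seidel_matrix_diag[OF assms] that X by simp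
  moreover have "flip a b X \<in> carrier_mat n n" using X by (simp add: flip_def)
  ultimately show ?thesis unfolding seidel_matrices_eq by blast
qed

text \<open>Reindexing the sum by the involution \<open>flip a b\<close> shows that it equals its
  own negative.\<close>

lemma avg_flip_odd:
  assumes "\<And>X. X \<in> seidel_matrices n \<Longrightarrow> F (flip a b X) = - F X"
  shows "avg n F = 0"
proof -
  have "(\<Sum>X\<in>seidel_matrices n. F X) = (\<Sum>X\<in>seidel_matrices n. F (flip a b X))"
    by (rule sum.reindex_bij_witness[of _ "flip a b" "flip a b"])
      (auto simp: flip_flip flip_in_seidel_matrices)
  also have "\<dots> = - (\<Sum>X\<in>seidel_matrices n. F X)"
    using assms by (simp add: sum_negf)
  finally show ?thesis by (simp add: avg_def)
qed

text \<open>Second moments of the signs in row \<open>v\<close>: for \<open>b = a\<close> the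
  product is 1, otherwise reversing the arc between \<open>v\<close> and \<open>a\<close> negates
  exactly one factor. Invariance of \<open>G\<close> expresses its independence of that arc.\<close>

lemma avg_row_quadratic:
  assumes lt: "v < n" "a < n" "b < n" and ne: "v \<noteq> a" "v \<noteq> b"
    and inv: "\<And>X. X \<in> seidel_matrices n \<Longrightarrow> G (flip v a X) = G X"
  shows "avg n (\<lambda>X. X $$ (v, a) * X $$ (v, b) * G X) = of_bool (b = a) * avg n G"
proof (cases "b = a")
  case True
  then show ?thesis using seidel_matrix_entry_sq lt ne by (simp cong: avg_cong)
next
  case False
  have "avg n (\<lambda>X. X $$ (v, a) * X $$ (v, b) * G X) = 0"
  proof (rule avg_flip_odd)
    fix X assume X: "X \<in> seidel_matrices n"
    then have "X \<in> carrier_mat n n" by (rule seidel_matrix_carrier)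
    then show "flip v a X $$ (v, a) * flip v a X $$ (v, b) * G (flip v a X)
        = - (X $$ (v, a) * X $$ (v, b) * G X)"
      using lt ne False inv[OF X] by (simp add: doubleton_eq_iff)
  qed
  then show ?thesis using False by simp
qed

text \<open>Fourth moments of independent signs: one term for each of the three pairings. If all
  four indices agree, these count 3 instead of 1, hence the correction by 2.\<close>

lemma avg_row_quartic:
  assumes lt: "v < n" "a < n" "b < n" "c < n" "d < n"
    and ne: "v \<noteq> a" "v \<noteq> b" "v \<noteq> c" "v \<noteq> d"
    and inv: "\<And>X e. X \<in> seidel_matrices n \<Longrightarrow> e \<in> {a, b, c, d} \<Longrightarrow> G (flip v e X) = G X"
  shows "avg n (\<lambda>X. X $$ (v, a) * X $$ (v, b) * (X $$ (v, c) * X $$ (v, d) * G X)) =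
    (of_bool (b = a) * of_bool (d = c) + of_bool (c = a) * of_bool (d = b)
      + of_bool (c = b) * of_bool (d = a) - 2 * of_bool (b = a) * of_bool (c = a) * of_bool (d = a))
    * avg n G" (is "?L = _")
proof -
  have sq: "X $$ (v, e) * (X $$ (v, e) * z) = z"
    if "X \<in> seidel_matrices n" "e \<in> {a, b, c, d}" for X e z
    using seidel_matrix_entry_sq[OF that(1), of v e] that lt ne by (auto simp flip: mult.assoc)
  have quad: "avg n (\<lambda>X. X $$ (v, e) * X $$ (v, f) * G X) = of_bool (f = e) * avg n G"
    if "e \<in> {a, b, c, d}" "f \<in> {a, b, c, d}" for e f
    using that lt ne inv by (intro avg_row_quadratic) auto
  \<comment> \<open>Either \<open>a\<close> has a partner, whose product with it is 1 and leaves a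
    second moment, or reversing the arc between \<open>v\<close> and \<open>a\<close> kills the
    average.\<close>
  consider "b = a" | "b \<noteq> a" "c = a" | "b \<noteq> a" "c \<noteq> a" "d = a" | "b \<noteq> a" "c \<noteq> a" "d \<noteq> a" by blast
  then show ?thesis
  proof cases
    case 1
    have "?L = avg n (\<lambda>X. X $$ (v, c) * X $$ (v, d) * G X)"
      using 1 sq by (intro avg_cong) (simp add: mult_ac)
    then show ?thesis using quad[of c d] 1 by auto
  next
    case 2
    have "?L = avg n (\<lambda>X. X $$ (v, b) * X $$ (v, d) * G X)"
      using 2 sq by (intro avg_cong) (simp add: mult_ac)
    then show ?thesis using quad[of b d] 2 by auto
  next
    case 3
    have "?L = avg n (\<lambda>X. X $$ (v, b) * X $$ (v, c) * G X)"
      using 3 sq by (intro avg_cong) (simp add: mult_ac)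
    then show ?thesis using quad[of b c] 3 by auto
  next
    case 4
    have "?L = 0"
    proof (rule avg_flip_odd)
      fix X assume X: "X \<in> seidel_matrices n"
      then have "X \<in> carrier_mat n n" by (rule seidel_matrix_carrier)
      then show "flip v a X $$ (v, a) * flip v a X $$ (v, b)
            * (flip v a X $$ (v, c) * flip v a X $$ (v, d) * G (flip v a X))
          = - (X $$ (v, a) * X $$ (v, b) * (X $$ (v, c) * X $$ (v, d) * G X))"
        using lt ne 4 inv[OF X] by (simp add: doubleton_eq_iff)
    qed
    then show ?thesis using 4 by auto
  qed
qed

section \<open>Principal minors indexed by vertex lists\<close>

text \<open>Lists make bordering by a vertex a \<open>Cons\<close> and deletion a
  \<open>remove1\<close>; \<open>minor_mset_cong\<close> shows that the order does not affect the
  determinant.\<close>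

definition principal :: "real mat \<Rightarrow> nat list \<Rightarrow> real mat" where
  "principal X xs = Matrix.mat (length xs) (length xs) (\<lambda>(i, j). X $$ (xs ! i, xs ! j))"

definition minor :: "real mat \<Rightarrow> nat list \<Rightarrow> real" where
  "minor X xs = Determinant.det (principal X xs)"

text \<open>For distinct \<open>xs\<close> this is the trace of the adjugate of
  \<open>principal X xs\<close>.\<close>

definition minor_sum :: "real mat \<Rightarrow> nat list \<Rightarrow> real" where
  "minor_sum X xs = (\<Sum>a\<in>set xs. minor X (remove1 a xs))"

lemma principal_carrier [simp]: "principal X xs \<in> carrier_mat (length xs) (length xs)"
  by (simp add: principal_def)

lemma dim_principal [simp]: "dim_row (principal X xs) = length xs" "dim_col (principal X xs) = length xs"
  by (simp_all add: principal_def)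

text \<open>Rows and columns are permuted by the same \<open>p\<close>, so its sign enters twice and
  cancels.\<close>

lemma minor_mset_cong:
  assumes "mset xs = mset ys"
  shows "minor X xs = minor X ys"
proof -
  obtain p where p: "p permutes {..<length ys}" and xs: "permute_list p ys = xs"
    using mset_eq_permutation[OF assms] .
  define k where "k = length ys"
  have pk: "p permutes {0..<k}" using p by (simp add: k_def atLeast0LessThan)
  have len: "length xs = k" using assms mset_eq_length k_def by blast
  have nth: "xs ! i = ys ! p i" if "i < k" for i
    using permute_list_nth[OF p] that xs k_def by metis
  have plt: "p i < k" if "i < k" for i using permutes_in_image[OF pk, of i] that by simp
  \<comment> \<open>\<open>Y\<close> has only its columns permuted; transposition later turns this
    into a row permutation.\<close>
  define Y where "Y = Matrix.mat k k (\<lambda>(i, j). principal X ys $$ (i, p j))"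
  have S: "principal X ys \<in> carrier_mat k k" by (simp add: k_def)
  have "principal X xs = Matrix.mat k k (\<lambda>(i, j). Y $$ (p i, j))"
  proof (rule eq_matI)
    fix i j assume "i < dim_row (Matrix.mat k k (\<lambda>(i, j). Y $$ (p i, j)))"
      "j < dim_col (Matrix.mat k k (\<lambda>(i, j). Y $$ (p i, j)))"
    then have ij: "i < k" "j < k" by simp_all
    then show "principal X xs $$ (i, j) = Matrix.mat k k (\<lambda>(i, j). Y $$ (p i, j)) $$ (i, j)"
      using plt[OF ij(1)] plt[OF ij(2)] nth[OF ij(1)] nth[OF ij(2)]
      by (simp add: principal_def Y_def len) (simp add: k_def)
  qed (simp_all add: principal_def len)
  then have 1: "minor X xs = signof p * Determinant.det Y"
    using Determinant.det_permute_rows[of Y k p] pk by (simp add: minor_def Y_def)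
  have "transpose_mat Y = Matrix.mat k k (\<lambda>(i, j). transpose_mat (principal X ys) $$ (p i, j))"
  proof (rule eq_matI)
    fix i j assume "i < dim_row (Matrix.mat k k (\<lambda>(i, j). transpose_mat (principal X ys) $$ (p i, j)))"
      "j < dim_col (Matrix.mat k k (\<lambda>(i, j). transpose_mat (principal X ys) $$ (p i, j)))"
    then have ij: "i < k" "j < k" by simp_all
    then show "transpose_mat Y $$ (i, j)
        = Matrix.mat k k (\<lambda>(i, j). transpose_mat (principal X ys) $$ (p i, j)) $$ (i, j)"
      using plt[OF ij(1)] by (simp add: Y_def) (simp add: k_def)
  qed (simp_all add: Y_def)
  then have "Determinant.det (transpose_mat Y) = signof p * Determinant.det (transpose_mat (principal X ys))"
    using Determinant.det_permute_rows[of "transpose_mat (principal X ys)" k p] pk S by simp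
  then have "Determinant.det Y = signof p * minor X ys"
    using Determinant.det_transpose[of Y k] Determinant.det_transpose[OF S]
    by (simp add: Y_def minor_def)
  with 1 show ?thesis by (simp add: sign_def)
qed

lemma mat_delete_principal:
  assumes "i < length xs" "distinct xs"
  shows "mat_delete (principal X xs) i i = principal X (remove1 (xs ! i) xs)"
proof -
  have "remove1 (xs ! i) xs = take i xs @ drop (Suc i) xs"
  proof -
    have "xs = take i xs @ xs ! i # drop (Suc i) xs" by (rule id_take_nth_drop[OF assms(1)])
    moreover have "xs ! i \<notin> set (take i xs)"
      using assms by (auto simp: in_set_conv_nth nth_eq_iff_index_eq)
    ultimately show ?thesis by (metis remove1.simps(2) remove1_append)
  qed
  then show ?thesis
    using assms(1) by (intro eq_matI) (auto simp: mat_delete_def principal_def nth_append min_def)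
qed

text \<open>Diagonal cofactors carry the sign +1. The function \<open>h\<close> will be the identity
  for the trace and squaring for the sum of squared minors.\<close>

lemma trace_adj_principal:
  assumes "distinct xs"
  shows "(\<Sum>i<length xs. h (adj_mat (principal X xs) $$ (i, i))) = (\<Sum>a\<in>set xs. h (minor X (remove1 a xs)))"
proof -
  have "(\<Sum>i<length xs. h (adj_mat (principal X xs) $$ (i, i)))
      = (\<Sum>i<length xs. h (minor X (remove1 (xs ! i) xs)))"
    using assms
    by (intro sum.cong refl) (simp add: adj_mat_def cofactor_def mat_delete_principal minor_def)
  also have "\<dots> = (\<Sum>a\<in>set xs. h (minor X (remove1 a xs)))"
    by (rule sum.reindex_bij_betw) (use bij_betw_nth[OF assms] in auto)
  finally show ?thesis .
qed

text \<open>No entry of the block lies in row or column \<open>v\<close>. This is the independence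
  of a block from the row that borders it.\<close>

lemma principal_flip:
  assumes "X \<in> carrier_mat n n" "set xs \<subseteq> {..<n}" "v \<notin> set xs"
  shows "principal (flip v w X) xs = principal X xs"
proof (rule eq_matI)
  fix i j assume ij: "i < dim_row (principal X xs)" "j < dim_col (principal X xs)"
  then have "xs ! i \<in> set xs" "xs ! j \<in> set xs" by (auto simp: principal_def)
  moreover from this have "xs ! i < n" "xs ! j < n" "{xs ! i, xs ! j} \<noteq> {v, w}"
    using assms by (auto simp: doubleton_eq_iff)
  ultimately show "principal (flip v w X) xs $$ (i, j) = principal X xs $$ (i, j)"
    using ij assms(1) by (simp add: principal_def)
qed (simp_all add: principal_def)

lemma transpose_principal:
  assumes "X \<in> seidel_matrices n" "set xs \<subseteq> {..<n}"
  shows "transpose_mat (principal X xs) = - principal X xs"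
proof (rule eq_matI)
  fix i j assume ij: "i < dim_row (- principal X xs)" "j < dim_col (- principal X xs)"
  then have lt: "xs ! i < n" "xs ! j < n" using assms nth_mem by (fastforce simp: principal_def)+
  then have "X $$ (xs ! j, xs ! i) = - X $$ (xs ! i, xs ! j)"
    using seidel_matrix_skew[OF assms(1)] by blast
  then show "transpose_mat (principal X xs) $$ (i, j) = (- principal X xs) $$ (i, j)"
    using ij by (simp add: principal_def)
qed (simp_all add: principal_def)

lemma minor_Cons:
  assumes X: "X \<in> seidel_matrices n" and sub: "set (v # xs) \<subseteq> {..<n}"
  shows "minor X (v # xs) = (\<Sum>i<length xs. \<Sum>j<length xs.
    X $$ (v, xs ! i) * X $$ (v, xs ! j) * adj_mat (principal X xs) $$ (i, j))"
proof -
  let ?A = "principal X (v # xs)"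
  have A: "?A \<in> carrier_mat (Suc (length xs)) (Suc (length xs))" by (simp add: principal_def)
  have del: "mat_delete ?A 0 0 = principal X xs"
    by (intro eq_matI) (auto simp: mat_delete_def principal_def)
  have "?A $$ (0, 0) = 0" using X sub by (simp add: principal_def seidel_matrix_diag)
  from det_skew_border[OF A transpose_principal[OF X sub] this]
  show ?thesis unfolding del minor_def by (simp add: principal_def)
qed

section \<open>Second moments of bordered minors\<close>

text \<open>The premise is a membership so that \<open>sum.cong\<close> supplies it inside nested
  sums.\<close>

lemma sum_of_bool_eq: "p \<in> {..<k} \<Longrightarrow> (\<Sum>q<k. of_bool (q = p) * h q) = (h p :: real)" for p k :: nat
proof -
  assume "p \<in> {..<k}"
  have "(\<Sum>q<k. of_bool (q = p) * h q) = (\<Sum>q<k. if q = p then h q else 0)"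
    by (intro sum.cong) auto
  then show ?thesis using \<open>p \<in> {..<k}\<close> by simp
qed

lemma double_sum_product:
  fixes f :: "'a \<Rightarrow> 'a \<Rightarrow> real"
  shows "(\<Sum>i\<in>I. \<Sum>j\<in>I. f i j) * (\<Sum>i\<in>I. \<Sum>j\<in>I. g i j)
    = (\<Sum>i\<in>I. \<Sum>p\<in>I. \<Sum>j\<in>I. \<Sum>q\<in>I. f i j * g p q)"
  by (simp add: sum_product)

text \<open>The square is a quartic form in the signs of row \<open>v\<close>, with coefficients
  independent of that row; the three pairings and the diagonal correction of
  \<open>avg_row_quartic\<close> give the four terms.\<close>

lemma avg_quadratic_form_sq:
  assumes dist: "distinct xs" and v: "v \<notin> set xs" and sub: "set (v # xs) \<subseteq> {..<n}"
    and inv: "\<And>X e. X \<in> seidel_matrices n \<Longrightarrow> C (flip v e X) = C X"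
  shows "avg n (\<lambda>X. (\<Sum>i<length xs. \<Sum>j<length xs. X $$ (v, xs ! i) * X $$ (v, xs ! j) * C X i j)\<^sup>2)
    = (\<Sum>i<length xs. \<Sum>j<length xs. avg n (\<lambda>X. C X i i * C X j j))
      + (\<Sum>i<length xs. \<Sum>j<length xs. avg n (\<lambda>X. C X i j * C X i j))
      + (\<Sum>i<length xs. \<Sum>j<length xs. avg n (\<lambda>X. C X i j * C X j i))
      - 2 * (\<Sum>i<length xs. avg n (\<lambda>X. C X i i * C X i i))"
proof -
  define k where "k = length xs"
  let ?a = "\<lambda>i p j q. avg n (\<lambda>X. C X i j * C X p q)"
  \<comment> \<open>The sums will be nested in the order \<open>i\<close>, \<open>p\<close>,
    \<open>j\<close>, \<open>q\<close>. Each \<open>of_bool\<close> is oriented so that it fixes a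
    variable by one bound further out and collapses its sum.\<close>
  have expand: "avg n (\<lambda>X. X $$ (v, xs ! i) * X $$ (v, xs ! j) * C X i j
        * (X $$ (v, xs ! p) * X $$ (v, xs ! q) * C X p q))
      = of_bool (j = i) * (of_bool (q = p) * ?a i p j q)
        + of_bool (p = i) * (of_bool (q = j) * ?a i p j q)
        + of_bool (j = p) * (of_bool (q = i) * ?a i p j q)
        - 2 * (of_bool (p = i) * (of_bool (j = i) * (of_bool (q = i) * ?a i p j q)))"
    if lt: "i < k" "p < k" "j < k" "q < k" for i p j q
  proof -
    have mem: "xs ! i \<in> set xs" "xs ! p \<in> set xs" "xs ! j \<in> set xs" "xs ! q \<in> set xs"
      using lt k_def by auto
    have lt': "xs ! i < n" "xs ! p < n" "xs ! j < n" "xs ! q < n" "v < n"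
      using mem sub by auto
    have ne: "v \<noteq> xs ! i" "v \<noteq> xs ! p" "v \<noteq> xs ! j" "v \<noteq> xs ! q"
      using mem v by metis+
    have eq: "xs ! a = xs ! b \<longleftrightarrow> a = b" if "a < k" "b < k" for a b
      using dist that nth_eq_iff_index_eq k_def by blast
    have "avg n (\<lambda>X. X $$ (v, xs ! i) * X $$ (v, xs ! j) * C X i j
        * (X $$ (v, xs ! p) * X $$ (v, xs ! q) * C X p q))
      = avg n (\<lambda>X. X $$ (v, xs ! i) * X $$ (v, xs ! j)
        * (X $$ (v, xs ! p) * X $$ (v, xs ! q) * (C X i j * C X p q)))"
      by (intro avg_cong) (simp add: mult_ac)
    also have "\<dots> = (of_bool (xs ! j = xs ! i) * of_bool (xs ! q = xs ! p)
      + of_bool (xs ! p = xs ! i) * of_bool (xs ! q = xs ! j)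
      + of_bool (xs ! p = xs ! j) * of_bool (xs ! q = xs ! i)
      - 2 * of_bool (xs ! j = xs ! i) * of_bool (xs ! p = xs ! i) * of_bool (xs ! q = xs ! i)) * ?a i p j q"
      by (rule avg_row_quartic) (use lt' ne inv in auto)
    also have "\<dots> = (of_bool (j = i) * of_bool (q = p) + of_bool (p = i) * of_bool (q = j)
      + of_bool (j = p) * of_bool (q = i)
      - 2 * of_bool (j = i) * of_bool (p = i) * of_bool (q = i)) * ?a i p j q"
      by (simp only: eq lt eq_commute[of p j])
    finally show ?thesis by (simp add: algebra_simps)
  qed
  have "avg n (\<lambda>X. (\<Sum>i<k. \<Sum>j<k. X $$ (v, xs ! i) * X $$ (v, xs ! j) * C X i j)\<^sup>2)
    = (\<Sum>i<k. \<Sum>p<k. \<Sum>j<k. \<Sum>q<k. avg n (\<lambda>X. X $$ (v, xs ! i) * X $$ (v, xs ! j) * C X i j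
        * (X $$ (v, xs ! p) * X $$ (v, xs ! q) * C X p q)))"
    unfolding power2_eq_square double_sum_product avg_sum ..
  also have "\<dots> = (\<Sum>i<k. \<Sum>p<k. \<Sum>j<k. \<Sum>q<k. 
        of_bool (j = i) * (of_bool (q = p) * ?a i p j q)
        + of_bool (p = i) * (of_bool (q = j) * ?a i p j q)
        + of_bool (j = p) * (of_bool (q = i) * ?a i p j q)
        - 2 * (of_bool (p = i) * (of_bool (j = i) * (of_bool (q = i) * ?a i p j q))))"
    by (intro sum.cong refl expand) auto
  also have "\<dots> = (\<Sum>i<k. \<Sum>p<k. \<Sum>j<k. of_bool (j = i) * (\<Sum>q<k. of_bool (q = p) * ?a i p j q))
      + (\<Sum>i<k. \<Sum>p<k. of_bool (p = i) * (\<Sum>j<k. \<Sum>q<k. of_bool (q = j) * ?a i p j q))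
      + (\<Sum>i<k. \<Sum>p<k. \<Sum>j<k. of_bool (j = p) * (\<Sum>q<k. of_bool (q = i) * ?a i p j q))
      - 2 * (\<Sum>i<k. \<Sum>p<k. of_bool (p = i) * (\<Sum>j<k. of_bool (j = i) * (\<Sum>q<k. of_bool (q = i) * ?a i p j q)))"
    by (simp only: sum.distrib sum_subtractf flip: sum_distrib_left)
  also have "\<dots> = (\<Sum>i<k. \<Sum>p<k. ?a i p i p) + (\<Sum>i<k. \<Sum>j<k. ?a i i j j)
      + (\<Sum>i<k. \<Sum>p<k. ?a i p p i) - 2 * (\<Sum>i<k. ?a i i i i)"
    by (simp only: sum_of_bool_eq cong: sum.cong)
  finally show ?thesis unfolding k_def .
qed

lemma adj_principal_flip:
  assumes "X \<in> seidel_matrices n" "v \<notin> set xs" "set xs \<subseteq> {..<n}"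
  shows "adj_mat (principal (flip v e X) xs) = adj_mat (principal X xs)"
  using principal_flip[OF seidel_matrix_carrier[OF assms(1)] assms(3,2)] by simp

lemma minor_sum_sq_eq:
  assumes "distinct xs"
  shows "(minor_sum X xs)\<^sup>2
    = (\<Sum>i<length xs. \<Sum>j<length xs. adj_mat (principal X xs) $$ (i, i) * adj_mat (principal X xs) $$ (j, j))"
  using trace_adj_principal[OF assms, of "\<lambda>x. x" X]
  by (simp add: minor_sum_def power2_eq_square flip: sum_product)

text \<open>For odd order the adjugate of the block is symmetric of rank at most one, so all three
  pairings yield the squared trace: hence the factor 3.\<close>

lemma avg_minor_sq_Cons:
  assumes dist: "distinct (v # xs)" and sub: "set (v # xs) \<subseteq> {..<n}" and odd: "odd (length xs)"
  shows "avg n (\<lambda>X. (minor X (v # xs))\<^sup>2) = 3 * avg n (\<lambda>X. (minor_sum X xs)\<^sup>2)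
    - 2 * (\<Sum>a\<in>set xs. avg n (\<lambda>X. (minor X (remove1 a xs))\<^sup>2))"
proof -
  define C where "C X i j = adj_mat (principal X xs) $$ (i, j)" for X i j
  let ?k = "length xs"
  have subs: "set xs \<subseteq> {..<n}" and v: "v \<notin> set xs" and d: "distinct xs" using sub dist by auto
  have sym: "C X i j = C X j i" and sq: "C X i j * C X i j = C X i i * C X j j"
    if X: "X \<in> seidel_matrices n" and ij: "i < ?k" "j < ?k" for X i j
  proof -
    note skew = transpose_principal[OF X subs]
    show sy: "C X i j = C X j i"
      unfolding C_def by (rule adj_mat_skew_odd_symmetric[OF principal_carrier skew odd ij])
    \<comment> \<open>The two by two minor of the adjugate on rows and columns \<open>i\<close>,
      \<open>j\<close>.\<close>
    have "C X i i * C X j j = C X i j * C X j i"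
      unfolding C_def
      using adj_mat_rank_one[OF principal_carrier det_skew_odd[OF principal_carrier skew odd] ij(1) ij(1) ij(2) ij(2)] .
    then show "C X i j * C X i j = C X i i * C X j j" using sy by simp
  qed
  have tr: "(\<Sum>i<?k. \<Sum>j<?k. avg n (\<lambda>X. C X i i * C X j j)) = avg n (\<lambda>X. (minor_sum X xs)\<^sup>2)"
    unfolding minor_sum_sq_eq[OF d] avg_sum C_def ..
  have 2: "(\<Sum>i<?k. \<Sum>j<?k. avg n (\<lambda>X. C X i j * C X i j)) = avg n (\<lambda>X. (minor_sum X xs)\<^sup>2)"
    unfolding tr[symmetric] by (intro sum.cong refl avg_cong) (simp add: sq)
  have 3: "(\<Sum>i<?k. \<Sum>j<?k. avg n (\<lambda>X. C X i j * C X j i)) = avg n (\<lambda>X. (minor_sum X xs)\<^sup>2)"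
    unfolding tr[symmetric]
  proof (intro sum.cong refl avg_cong)
    fix i j X assume "i \<in> {..<?k}" "j \<in> {..<?k}" and X: "X \<in> seidel_matrices n"
    then have ij: "i < ?k" "j < ?k" by simp_all
    show "C X i j * C X j i = C X i i * C X j j"
      using sq[OF X ij] sym[OF X ij] by simp
  qed
  have "(\<Sum>i<?k. avg n (\<lambda>X. C X i i * C X i i)) = avg n (\<lambda>X. \<Sum>i<?k. (C X i i)\<^sup>2)"
    by (simp add: avg_sum power2_eq_square)
  also have "\<dots> = (\<Sum>a\<in>set xs. avg n (\<lambda>X. (minor X (remove1 a xs))\<^sup>2))"
    unfolding C_def trace_adj_principal[OF d, of "\<lambda>x. x\<^sup>2"] avg_sum ..
  finally have diag: "(\<Sum>i<?k. avg n (\<lambda>X. C X i i * C X i i))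
    = (\<Sum>a\<in>set xs. avg n (\<lambda>X. (minor X (remove1 a xs))\<^sup>2))" .
  have "avg n (\<lambda>X. (minor X (v # xs))\<^sup>2) =
      avg n (\<lambda>X. (\<Sum>i<?k. \<Sum>j<?k. X $$ (v, xs ! i) * X $$ (v, xs ! j) * C X i j)\<^sup>2)"
    unfolding C_def by (rule avg_cong) (simp only: minor_Cons[OF _ sub])
  also have "\<dots> = (\<Sum>i<?k. \<Sum>j<?k. avg n (\<lambda>X. C X i i * C X j j))
      + (\<Sum>i<?k. \<Sum>j<?k. avg n (\<lambda>X. C X i j * C X i j))
      + (\<Sum>i<?k. \<Sum>j<?k. avg n (\<lambda>X. C X i j * C X j i))
      - 2 * (\<Sum>i<?k. avg n (\<lambda>X. C X i i * C X i i))"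
    by (rule avg_quadratic_form_sq[OF d v sub])
      (auto simp: C_def fun_eq_iff adj_principal_flip[OF _ v subs])
  finally show ?thesis unfolding tr 2 3 diag by simp
qed

text \<open>Both minors are quadratic forms in the same adjugate, in rows that share no arc.
  Averaging over each row separately leaves only diagonal entries, whose products add up to the
  squared trace.\<close>

lemma avg_minor_Cons_mult_minor_Cons:
  assumes dist: "distinct (a # b # xs)" and sub: "set (a # b # xs) \<subseteq> {..<n}"
  shows "avg n (\<lambda>X. minor X (a # xs) * minor X (b # xs)) = avg n (\<lambda>X. (minor_sum X xs)\<^sup>2)"
proof -
  define C where "C X i j = adj_mat (principal X xs) $$ (i, j)" for X i j
  define k where "k = length xs"
  have d: "distinct xs" and subs: "set xs \<subseteq> {..<n}" and ab: "a \<noteq> b" "a \<notin> set xs" "b \<notin> set xs" "a < n" "b < n"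
    using dist sub by auto
  let ?c = "\<lambda>i p j q. avg n (\<lambda>X. C X i j * C X p q)"
  have expand: "avg n (\<lambda>X. X $$ (a, xs ! i) * X $$ (a, xs ! j) * C X i j
        * (X $$ (b, xs ! p) * X $$ (b, xs ! q) * C X p q))
      = of_bool (j = i) * (of_bool (q = p) * ?c i p j q)"
    if lt: "i < k" "p < k" "j < k" "q < k" for i p j q
  proof -
    have mem: "xs ! i \<in> set xs" "xs ! p \<in> set xs" "xs ! j \<in> set xs" "xs ! q \<in> set xs"
      using lt k_def by auto
    have lt': "xs ! i < n" "xs ! p < n" "xs ! j < n" "xs ! q < n"
      using mem subs by auto
    have ne: "a \<noteq> xs ! i" "b \<noteq> xs ! p" "a \<noteq> xs ! j" "b \<noteq> xs ! q" "a \<noteq> xs ! p" "a \<noteq> xs ! q"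
      using mem ab by metis+
    have eq: "xs ! a = xs ! b \<longleftrightarrow> a = b" if "a < k" "b < k" for a b
      using d that nth_eq_iff_index_eq k_def by blast
    have C_flip: "C (flip v e X) = C X" if "X \<in> seidel_matrices n" "v \<notin> set xs" for X v e
      using adj_principal_flip[OF that subs] by (simp add: C_def fun_eq_iff)
    have "avg n (\<lambda>X. X $$ (a, xs ! i) * X $$ (a, xs ! j) * C X i j
        * (X $$ (b, xs ! p) * X $$ (b, xs ! q) * C X p q))
      = avg n (\<lambda>X. X $$ (a, xs ! i) * X $$ (a, xs ! j)
        * (X $$ (b, xs ! p) * X $$ (b, xs ! q) * (C X i j * C X p q)))"
      by (intro avg_cong) (simp add: mult_ac)
    \<comment> \<open>Row \<open>a\<close> is averaged first: since \<open>a\<close> is neither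
      \<open>b\<close> nor in \<open>xs\<close>, reversing an arc from \<open>a\<close> to the block
      changes neither the factors in row \<open>b\<close> nor the adjugate.\<close>
    also have "\<dots> = of_bool (xs ! j = xs ! i)
        * avg n (\<lambda>X. X $$ (b, xs ! p) * X $$ (b, xs ! q) * (C X i j * C X p q))"
    proof (rule avg_row_quadratic)
      fix X assume X: "X \<in> seidel_matrices n"
      show "flip a (xs ! i) X $$ (b, xs ! p) * flip a (xs ! i) X $$ (b, xs ! q)
          * (C (flip a (xs ! i) X) i j * C (flip a (xs ! i) X) p q)
        = X $$ (b, xs ! p) * X $$ (b, xs ! q) * (C X i j * C X p q)"
        using seidel_matrix_carrier[OF X] lt' ne ab C_flip[OF X ab(2)] by (simp add: doubleton_eq_iff)
    qed (use lt' ne ab in auto)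
    also have "avg n (\<lambda>X. X $$ (b, xs ! p) * X $$ (b, xs ! q) * (C X i j * C X p q))
      = of_bool (xs ! q = xs ! p) * ?c i p j q"
      by (rule avg_row_quadratic) (use lt' ne ab C_flip in auto)
    finally show ?thesis by (simp only: eq lt)
  qed
  have "avg n (\<lambda>X. minor X (a # xs) * minor X (b # xs)) =
      avg n (\<lambda>X. (\<Sum>i<k. \<Sum>j<k. X $$ (a, xs ! i) * X $$ (a, xs ! j) * C X i j)
        * (\<Sum>i<k. \<Sum>j<k. X $$ (b, xs ! i) * X $$ (b, xs ! j) * C X i j))"
    unfolding C_def k_def by (rule avg_cong) (use sub in \<open>simp add: minor_Cons\<close>)
  also have "\<dots> = (\<Sum>i<k. \<Sum>p<k. \<Sum>j<k. \<Sum>q<k. avg n (\<lambda>X. X $$ (a, xs ! i) * X $$ (a, xs ! j) * C X i j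
        * (X $$ (b, xs ! p) * X $$ (b, xs ! q) * C X p q)))"
    unfolding double_sum_product avg_sum ..
  also have "\<dots> = (\<Sum>i<k. \<Sum>p<k. \<Sum>j<k. \<Sum>q<k. of_bool (j = i) * (of_bool (q = p) * ?c i p j q))"
    by (intro sum.cong refl expand) auto
  also have "\<dots> = (\<Sum>i<k. \<Sum>p<k. ?c i p i p)"
    by (simp only: sum_of_bool_eq sum_distrib_left[symmetric] cong: sum.cong)
  also have "\<dots> = avg n (\<lambda>X. (minor_sum X xs)\<^sup>2)"
    unfolding minor_sum_sq_eq[OF d] avg_sum C_def k_def ..
  finally show ?thesis .
qed

text \<open>Expand the square. Equal indices give squared minors; distinct \<open>a\<close>,
  \<open>b\<close> give two minors that border the common block without \<open>a\<close> and
  \<open>b\<close>.\<close>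

lemma avg_minor_sum_sq:
  assumes dist: "distinct xs" and sub: "set xs \<subseteq> {..<n}"
  shows "avg n (\<lambda>X. (minor_sum X xs)\<^sup>2) = (\<Sum>a\<in>set xs. avg n (\<lambda>X. (minor X (remove1 a xs))\<^sup>2))
    + (\<Sum>a\<in>set xs. \<Sum>b\<in>set xs - {a}. avg n (\<lambda>X. (minor_sum X (remove1 a (remove1 b xs)))\<^sup>2))"
proof -
  let ?m = "\<lambda>a b. avg n (\<lambda>X. minor X (remove1 a xs) * minor X (remove1 b xs))"
  have off: "?m a b = avg n (\<lambda>X. (minor_sum X (remove1 a (remove1 b xs)))\<^sup>2)"
    if "a \<in> set xs" "b \<in> set xs - {a}" for a b
  proof -
    let ?ys = "remove1 a (remove1 b xs)"
    have rem: "mset zs = mset (c # remove1 c zs)" if "c \<in> set zs" for c and zs :: "nat list"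
      using that by simp
    \<comment> \<open>Removing \<open>a\<close> keeps \<open>b\<close>, and conversely; moving the
      kept vertex to the front exhibits it as the border.\<close>
    have "mset (remove1 a xs) = mset (b # ?ys)" "mset (remove1 b xs) = mset (a # ?ys)"
      using that rem[of b "remove1 a xs"] rem[of a "remove1 b xs"]
      unfolding remove1_commute[of b a] by (metis DiffE in_set_remove1 singletonI)+
    then have "minor X (remove1 a xs) = minor X (b # ?ys)" "minor X (remove1 b xs) = minor X (a # ?ys)" for X
      by (blast intro: minor_mset_cong)+
    moreover have "distinct (b # a # ?ys)" using that dist by (simp add: set_remove1_eq distinct_remove1)
    moreover have "set (b # a # ?ys) \<subseteq> {..<n}"
      using that sub set_remove1_subset[of a "remove1 b xs"] set_remove1_subset[of b xs] by auto
    ultimately show ?thesis using avg_minor_Cons_mult_minor_Cons[of b a ?ys n] by simp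
  qed
  have "avg n (\<lambda>X. (minor_sum X xs)\<^sup>2) = (\<Sum>a\<in>set xs. \<Sum>b\<in>set xs. ?m a b)"
    unfolding minor_sum_def power2_eq_square sum_product avg_sum ..
  also have "\<dots> = (\<Sum>a\<in>set xs. ?m a a + (\<Sum>b\<in>set xs - {a}. ?m a b))"
    by (intro sum.cong refl sum.remove) auto
  also have "\<dots> = (\<Sum>a\<in>set xs. ?m a a) + (\<Sum>a\<in>set xs. \<Sum>b\<in>set xs - {a}. ?m a b)"
    by (rule sum.distrib)
  finally show ?thesis using off by (simp add: power2_eq_square)
qed

section \<open>The recurrence and its solution\<close>

text \<open>Simultaneous induction on even and odd orders; the odd part is the border formula solved
  for the mean squared trace. Keeping \<open>n\<close> fixed and varying the vertex list avoids
  comparing averages over tournaments of different orders.\<close>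

lemma avg_minor_sq_recurrence:
  fixes z :: "nat \<Rightarrow> real"
  assumes z0: "z 0 = 1" and z2: "z 2 = 1"
    and rec: "\<And>m. even m \<Longrightarrow> m \<ge> 4 \<Longrightarrow> z m = (real m - 1)\<^sup>2 * z (m - 2)
      + 2 * (real m - 1) * (real m - 2) * (real m - 3) * z (m - 4)"
  shows "(\<forall>xs. distinct xs \<longrightarrow> set xs \<subseteq> {..<n} \<longrightarrow> length xs = 2 * m \<longrightarrow>
        avg n (\<lambda>X. (minor X xs)\<^sup>2) = z (2 * m)) \<and>
    (\<forall>xs. distinct xs \<longrightarrow> set xs \<subseteq> {..<n} \<longrightarrow> length xs = 2 * m + 1 \<longrightarrow>
        3 * avg n (\<lambda>X. (minor_sum X xs)\<^sup>2) = z (2 * m + 2) + 2 * (2 * real m + 1) * z (2 * m))"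
proof (induction m)
  case 0
  have 1: "minor X [] = 1" for X by (simp add: minor_def principal_def)
  \<comment> \<open>Deleting the only vertex leaves the empty minor 1, so the odd part reads
    \<open>3 = z 2 + 2 * z 0\<close>.\<close>
  have "minor_sum X xs = 1" if "length xs = 1" for X xs
    using that by (auto simp: minor_sum_def length_Suc_conv 1)
  then show ?case using z0 z2 by (simp add: 1 avg_const flip: numeral_2_eq_2)
next
  case (Suc m)
  have even: "avg n (\<lambda>X. (minor X xs)\<^sup>2) = z (2 * Suc m)"
    if xs: "distinct xs" "set xs \<subseteq> {..<n}" "length xs = 2 * Suc m" for xs
  proof -
    obtain v ys where v: "xs = v # ys" using xs(3) by (cases xs) auto
    have ys: "distinct ys" "set ys \<subseteq> {..<n}" "length ys = 2 * m + 1" using xs v by auto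
    have "avg n (\<lambda>X. (minor X (remove1 a ys))\<^sup>2) = z (2 * m)" if "a \<in> set ys" for a
    proof -
      have "distinct (remove1 a ys)" "set (remove1 a ys) \<subseteq> {..<n}" "length (remove1 a ys) = 2 * m"
        using ys that set_remove1_subset[of a ys] by (auto simp: length_remove1 distinct_remove1)
      then show ?thesis using Suc.IH by blast
    qed
    then have "(\<Sum>a\<in>set ys. avg n (\<lambda>X. (minor X (remove1 a ys))\<^sup>2)) = (2 * real m + 1) * z (2 * m)"
      using ys by (simp add: distinct_card)
    moreover have "3 * avg n (\<lambda>X. (minor_sum X ys)\<^sup>2) = z (2 * m + 2) + 2 * (2 * real m + 1) * z (2 * m)"
      using Suc.IH ys by blast
    \<comment> \<open>The correction in the border formula cancels the multiple of
      \<open>z (2 * m)\<close> in the odd hypothesis.\<close>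
    ultimately show ?thesis
      using avg_minor_sq_Cons[of v ys n] xs ys v by simp
  qed
  have "3 * avg n (\<lambda>X. (minor_sum X xs)\<^sup>2)
      = z (2 * Suc m + 2) + 2 * (2 * real (Suc m) + 1) * z (2 * Suc m)"
    if xs: "distinct xs" "set xs \<subseteq> {..<n}" "length xs = 2 * Suc m + 1" for xs
  proof -
    define k where "k = real (2 * m + 3)"
    have card: "real (card (set xs)) = k" using xs by (simp add: distinct_card k_def)
    have "avg n (\<lambda>X. (minor X (remove1 a xs))\<^sup>2) = z (2 * Suc m)" if "a \<in> set xs" for a
      using that xs set_remove1_subset[of a xs]
      by (intro even) (auto simp: length_remove1 distinct_remove1)
    then have 1: "(\<Sum>a\<in>set xs. avg n (\<lambda>X. (minor X (remove1 a xs))\<^sup>2)) = k * z (2 * Suc m)"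
      using card by simp
    have 2: "3 * avg n (\<lambda>X. (minor_sum X (remove1 a (remove1 b xs)))\<^sup>2)
        = z (2 * m + 2) + 2 * (2 * real m + 1) * z (2 * m)"
      if "a \<in> set xs" "b \<in> set xs - {a}" for a b
    proof -
      have "length (remove1 a (remove1 b xs)) = 2 * m + 1"
        using that xs by (simp add: length_remove1)
      moreover have "distinct (remove1 a (remove1 b xs))" using xs by (simp add: distinct_remove1)
      moreover have "set (remove1 a (remove1 b xs)) \<subseteq> {..<n}"
        using xs set_remove1_subset[of a "remove1 b xs"] set_remove1_subset[of b xs] by blast
      ultimately show ?thesis using Suc.IH by blast
    qed
    have "3 * (\<Sum>a\<in>set xs. \<Sum>b\<in>set xs - {a}. avg n (\<lambda>X. (minor_sum X (remove1 a (remove1 b xs)))\<^sup>2))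
        = (\<Sum>a\<in>set xs. \<Sum>b\<in>set xs - {a}. z (2 * m + 2) + 2 * (2 * real m + 1) * z (2 * m))"
      unfolding sum_distrib_left by (intro sum.cong refl 2)
    also have "\<dots> = k * ((k - 1) * (z (2 * m + 2) + 2 * (2 * real m + 1) * z (2 * m)))"
      using card xs by (simp add: card_Diff_singleton distinct_card k_def)
    finally have "3 * avg n (\<lambda>X. (minor_sum X xs)\<^sup>2)
        = 3 * k * z (2 * m + 2) + k * (k - 1) * (z (2 * m + 2) + 2 * (2 * real m + 1) * z (2 * m))"
      unfolding avg_minor_sum_sq[OF xs(1,2)] 1 by (simp add: algebra_simps)
    moreover have "z (2 * Suc m + 2) = k\<^sup>2 * z (2 * m + 2) + 2 * k * (k - 1) * (k - 2) * z (2 * m)"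
    proof -
      have eqs: "2 * Suc m + 2 = 2 * m + 4" "2 * m + 4 - 2 = 2 * m + 2" "2 * m + 4 - 4 = 2 * m"
        "real (2 * m + 4) - 1 = k" "real (2 * m + 4) - 2 = k - 1" "real (2 * m + 4) - 3 = k - 2"
        by (simp_all add: k_def)
      show ?thesis using rec[of "2 * m + 4"] unfolding eqs by simp
    qed
    \<comment> \<open>With \<open>2 * m + 1 = k - 2\<close>, both sides have coefficient
      \<open>k * k + 2 * k\<close> at \<open>z (2 * m + 2)\<close> and
      \<open>2 * k * (k - 1) * (k - 2)\<close> at \<open>z (2 * m)\<close>.\<close>
    ultimately show ?thesis by (simp add: k_def algebra_simps power2_eq_square)
  qed
  then show ?case using even by blast
qed

theorem theorem4p2:
  fixes y :: "nat \<Rightarrow> real" and n :: nat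
  assumes y0: "y 0 = 1" and y2: "y 2 = 1"
    and rec: "\<And>m. even m \<Longrightarrow> m \<ge> 4 \<Longrightarrow>
      y m = (real m - 1) * y (m - 2) + (2 * real m - 4) * y (m - 4)"
    and "even n"
  shows "measure_pmf.expectation (pmf_of_set (seidel_matrices n)) (\<lambda>X. (Determinant.det X)\<^sup>2)
      = y n * of_int (dfact (int n - 1))"
proof -
  define z where "z k = y k * of_int (dfact (int k - 1))" for k :: nat
  have z0: "z 0 = 1" and z2: "z 2 = 1" using y0 y2 by (simp_all add: z_def dfact.simps)
  have zrec: "z k = (real k - 1)\<^sup>2 * z (k - 2)
      + 2 * (real k - 1) * (real k - 2) * (real k - 3) * z (k - 4)"
    if "even k" "k \<ge> 4" for k
  proof -
    have d: "dfact (int k - 1) = (int k - 1) * dfact (int k - 3)"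
      "dfact (int k - 3) = (if k = 4 then 1 else (int k - 3) * dfact (int k - 5))"
      using that dfact.simps[of "int k - 1"] dfact.simps[of "int k - 3"] by auto
    \<comment> \<open>For \<open>k = 4\<close> this relies on the convention that the double
      factorial of -1 is 1.\<close>
    have "dfact (int k - 3) = (int k - 3) * dfact (int k - 5)"
      using d(2) dfact.simps[of "-1"] by (cases "k = 4") auto
    then have "real_of_int (dfact (int k - 1)) = (real k - 1) * real_of_int (dfact (int k - 3))"
      "real_of_int (dfact (int k - 3)) = (real k - 3) * real_of_int (dfact (int k - 5))"
      using d(1) by simp_all
    moreover have "int (k - 2) - 1 = int k - 3" "int (k - 4) - 1 = int k - 5" using that by auto
    \<comment> \<open>Multiply the recurrence for \<open>y\<close> by
      \<open>dfact (int k - 1)\<close>: one factor \<open>k - 1\<close> is split off for the first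
      term, and both \<open>k - 1\<close> and \<open>k - 3\<close> for the second, where
      \<open>2 * k - 4 = 2 * (k - 2)\<close>.\<close>
    ultimately show ?thesis
      unfolding z_def by (simp only: rec[OF that]) (simp add: algebra_simps power2_eq_square)
  qed
  obtain m where n: "n = 2 * m" using \<open>even n\<close> by blast
  have "distinct [0..<n]" "set [0..<n] \<subseteq> {..<n}" "length [0..<n] = 2 * m" using n by auto
  then have "avg n (\<lambda>X. (minor X [0..<n])\<^sup>2) = z n"
    using avg_minor_sq_recurrence[OF z0 z2 zrec, of n m] n by blast
  moreover have "minor X [0..<n] = Determinant.det X" if "X \<in> seidel_matrices n" for X
  proof -
    have "principal X [0..<n] = X" using seidel_matrix_carrier[OF that] by (intro eq_matI) (auto simp: principal_def)
    then show ?thesis by (simp add: minor_def)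
  qed
  ultimately have "avg n (\<lambda>X. (Determinant.det X)\<^sup>2) = z n" by (simp cong: avg_cong)
  then show ?thesis
    using integral_pmf_of_set[OF seidel_matrices_nonempty finite_seidel_matrices]
    by (simp add: avg_def z_def)
qed

end
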